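(* Assume the continuum hypothesis. Then there exists a free ultrafilter on $\mathbb{N}$ that is strongly diagonal.
   Context: A filter on $\mathbb{N}$ is free if it contains all subsets of $\mathbb{N}$ with finite complement. For a filter $\mathcal{F}$ on $\mathbb{N}$, a set $I\subset\mathbb{N}$ is $\mathcal{F}$-stationary if $I\cap A\neq\emptyset$ for every $A\in\mathcal{F}$; $\mathcal{F}^*$ denotes the collection of all $\mathcal{F}$-stationary sets. $\mathcal{F}$ is strongly diagonal if for every decreasing sequence $A_1\supset A_2\supset\cdots$ of elements of $\mathcal{F}$ and every $I\in\mathcal{F}^*$ there is $J\in\mathcal{F}^*$, $J\subset I$, such that $|(J\cap A_n)\setminus A_{n+1}|\le 1$ for all $n\in\mathbb{N}$. *)

theory Defs
  imports Complex_Main "HOL-Library.Equipollence"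
begin

definition continuum_hypothesis :: bool where
  "continuum_hypothesis \<longleftrightarrow>
     \<not> (\<exists>S :: real set. (UNIV :: nat set) \<prec> S \<and> S \<prec> (UNIV :: real set))"

definition filter_sets :: "'a filter \<Rightarrow> 'a set set" where
  "filter_sets F = {A. eventually (\<lambda>x. x \<in> A) F}"

definition free_filter :: "'a filter \<Rightarrow> bool" where
  "free_filter F \<longleftrightarrow> (\<forall>A. finite (- A) \<longrightarrow> A \<in> filter_sets F)"

text \<open>
  The type of filters includes the improper filter \<^term>\<open>bot\<close>, which contains the empty set,
  and its order is reverse inclusion: \<^prop>\<open>G \<le> F\<close> means that every set of \<^term>\<open>F\<close> belongs
  to \<^term>\<open>G\<close>. An ultrafilter is a proper filter that is maximal with respect to inclusion.
\<close>

definition ultrafilter :: "'a filter \<Rightarrow> bool" where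
  "ultrafilter F \<longleftrightarrow> F \<noteq> bot \<and> (\<forall>G. G \<noteq> bot \<longrightarrow> G \<le> F \<longrightarrow> G = F)"

definition stationary :: "'a filter \<Rightarrow> 'a set set" where
  "stationary F = {I. \<forall>A \<in> filter_sets F. I \<inter> A \<noteq> {}}"

text \<open>
  The condition that a set has at most one element includes finiteness explicitly, since
  \<^const>\<open>card\<close> is \<open>0\<close> on infinite sets.
\<close>

definition strongly_diagonal :: "'a filter \<Rightarrow> bool" where
  "strongly_diagonal F \<longleftrightarrow>
     (\<forall>A :: nat \<Rightarrow> 'a set. \<forall>I. decseq A \<longrightarrow> (\<forall>n. A n \<in> filter_sets F) \<longrightarrow> I \<in> stationary F \<longrightarrow>
        (\<exists>J \<in> stationary F. J \<subseteq> I \<and>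
           (\<forall>n. finite ((J \<inter> A n) - A (Suc n)) \<and> card ((J \<inter> A n) - A (Suc n)) \<le> 1)))"

lemma ultrafilter_iff:
  "ultrafilter F \<longleftrightarrow> F \<noteq> bot \<and> (\<forall>A. A \<in> filter_sets F \<or> - A \<in> filter_sets F)"
proof (intro iffI conjI allI)
  fix A assume F: "ultrafilter F"
  show "A \<in> filter_sets F \<or> - A \<in> filter_sets F"
  proof (rule disjCI)
    assume nA: "- A \<notin> filter_sets F"
    let ?G = "inf F (principal A)"
    have "?G \<noteq> bot"
      using nA by (auto simp: filter_sets_def trivial_limit_def eventually_inf_principal)
    then have "?G = F"
      using F by (auto simp: ultrafilter_def)
    moreover have "eventually (\<lambda>x. x \<in> A) ?G"
      by (simp add: eventually_inf_principal)
    ultimately show "A \<in> filter_sets F"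
      by (simp add: filter_sets_def)
  qed
next
  assume F: "F \<noteq> bot \<and> (\<forall>A. A \<in> filter_sets F \<or> - A \<in> filter_sets F)"
  have "F \<le> G" if G: "G \<noteq> bot" "G \<le> F" for G
  proof (rule filter_leI)
    fix P assume P: "eventually P G"
    show "eventually P F"
    proof (rule ccontr)
      assume "\<not> eventually P F"
      then have "Collect P \<notin> filter_sets F"
        by (simp add: filter_sets_def)
      then have "eventually (\<lambda>x. \<not> P x) F"
        using F unfolding filter_sets_def by fastforce
      then have "eventually (\<lambda>x. \<not> P x) G"
        using G by (simp add: le_filter_def)
      with P have "eventually (\<lambda>x. False) G"
        by eventually_elim simp
      with G show False
        by (simp add: trivial_limit_def)
    qed
  qed
  with F show "ultrafilter F"
    unfolding ultrafilter_def by (auto intro: antisym)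
qed (auto simp: ultrafilter_def)

end

(* Under the continuum hypothesis the sequences of subsets of N can be well-ordered with countable
   initial segments. Along this order one builds infinite sets, decreasing modulo finite sets: at
   each stage the earlier sets have an infinite pseudo-intersection X, which is thinned out to an
   infinite J that settles the current sequence A, i.e. J either avoids some A n, or lies in A 0 and
   meets every A n - A (n + 1) in at most one point. The sets that contain almost all of some J form
   the desired filter; the constant sequences make it an ultrafilter. *)

theory Submission
  imports Defs "HOL-Analysis.Abstract_Topology_2"
begin

text \<open>The pairing function turns the graph of a sequence of sets into a single set of
  naturals, and there are continuum many of those.\<close>

lemma nat_set_sequences_lepoll_reals: "(UNIV :: (nat \<Rightarrow> nat set) set) \<lesssim> (UNIV :: real set)"
proof -
  have "inj (\<lambda>A :: nat \<Rightarrow> nat set. {prod_encode (n, m) |n m. m \<in> A n})"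
  proof (rule inj_on_inverseI)
    fix A :: "nat \<Rightarrow> nat set"
    show "(\<lambda>n. {m. prod_encode (n, m) \<in> {prod_encode (n, m) |n m. m \<in> A n}}) = A"
      by auto
  qed
  then have "(UNIV :: (nat \<Rightarrow> nat set) set) \<lesssim> (UNIV :: nat set set)"
    unfolding lepoll_def by blast
  then show ?thesis
    using nat_sets_eqpoll_reals lepoll_trans2 by blast
qed

text \<open>A cardinal well-order has order type as short as possible, so each of its initial
  segments is strictly smaller than the whole type, hence than the reals. \<open>R\<close> is its
  strict part.\<close>

lemma continuum_hypothesis_countable_segments:
  includes cardinal_syntax
  assumes CH: "continuum_hypothesis" and le: "(UNIV :: 'i set) \<lesssim> (UNIV :: real set)"
  obtains R :: "'i rel" where "wf R" "total R" "\<And>i. countable {j. (j, i) \<in> R}"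
proof
  let ?r = "|UNIV :: 'i set|"
  have wo: "well_order ?r"
    by (rule card_of_well_order_on)
  show "wf (?r - Id)"
    using wo by (simp add: well_order_on_def)
  show "total (?r - Id)"
    using wo by (auto simp: order_on_defs total_on_def)
  fix i
  have eq: "{j. (j, i) \<in> ?r - Id} = underS ?r i"
    by (auto simp: underS_def)
  have "|underS ?r i| <o ?r"
    by (rule card_of_underS) (simp_all add: Field_card_of card_of_card_order_on)
  then have less: "underS ?r i \<prec> (UNIV :: 'i set)"
    using subset_imp_lepoll[OF subset_UNIV] not_ordLess_ordIso
    by (metis lepoll_iff_leqpoll eqpoll_iff_card_of_ordIso)
  \<comment> \<open>The continuum hypothesis speaks of sets of reals, so the segment is moved
    there.\<close>
  obtain g :: "'i \<Rightarrow> real" where g: "inj g"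
    using le unfolding lepoll_def by blast
  have ge: "g ` underS ?r i \<approx> underS ?r i"
    using g inj_on_image_eqpoll_self inj_on_subset by blast
  then have "g ` underS ?r i \<prec> (UNIV :: real set)"
    using less le eq_lesspoll_trans lesspoll_trans2 by blast
  then have "\<not> (UNIV :: nat set) \<prec> g ` underS ?r i"
    using CH unfolding continuum_hypothesis_def by blast
  \<comment> \<open>If infinite, the image would receive an injection from the naturals; not being
    strictly larger, it is equipollent to them.\<close>
  then have "countable (g ` underS ?r i)"
    by (metis countableI_type countable_eqpoll eqpoll_sym infinite_le_lepoll lepoll_iff_leqpoll
        countable_finite)
  then show "countable {j. (j, i) \<in> ?r - Id}"
    unfolding eq using ge by (metis countable_eqpoll eqpoll_sym)
qed

text \<open>Diagonalisation: the n-th point is taken from the intersection of the first n + 1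
  members, beyond the previous point, so only finitely many points miss a given member.\<close>

lemma infinite_pseudo_intersection:
  fixes \<C> :: "nat set set"
  assumes "countable \<C>" and inf: "\<And>\<T>. finite \<T> \<Longrightarrow> \<T> \<subseteq> \<C> \<Longrightarrow> infinite (\<Inter>\<T>)"
  shows "\<exists>X. infinite X \<and> (\<forall>B \<in> \<C>. finite (X - B))"
proof (cases "\<C> = {}")
  case True
  then show ?thesis
    by (intro exI[of _ UNIV]) simp
next
  case False
  then have range: "range (from_nat_into \<C>) = \<C>"
    using assms(1) by simp
  define C where "C n = \<Inter> (from_nat_into \<C> ` {..n})" for n
  have "infinite (C n)" for n
    unfolding C_def using range by (intro inf) auto
  then have ex: "\<exists>k>m. k \<in> C n" for m n
    unfolding infinite_nat_iff_unbounded by blast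
  obtain x where x: "\<And>n. x n \<in> C n" "\<And>n. x n < x (Suc n)"
    using dependent_nat_choice[of "\<lambda>n k. k \<in> C n" "\<lambda>_ k l. k < l"] ex by metis
  show ?thesis
  proof (intro exI conjI ballI)
    have "strict_mono x"
      using x(2) by (simp add: strict_mono_Suc_iff)
    then show "infinite (range x)"
      using range_inj_infinite strict_mono_imp_inj_on by blast
    fix B assume "B \<in> \<C>"
    then obtain k where k: "B = from_nat_into \<C> k"
      using range by blast
    have "x n \<in> B" if "k \<le> n" for n
      using x(1)[of n] that by (auto simp: C_def k)
    then have "range x - B \<subseteq> x ` {..<k}"
      using not_le by blast
    then show "finite (range x - B)"
      using finite_subset by blast
  qed
qed

text \<open>Inclusion modulo finite sets is transitive, so a new set either leaves the old least set
  least or becomes least itself.\<close>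

lemma finite_chain_mod_finite_least:
  assumes "finite \<T>" "\<T> \<noteq> {}" and "\<And>A B. A \<in> \<T> \<Longrightarrow> B \<in> \<T> \<Longrightarrow> finite (A - B) \<or> finite (B - A)"
  shows "\<exists>A \<in> \<T>. \<forall>B \<in> \<T>. finite (A - B)"
  using assms
proof (induction rule: finite_ne_induct)
  case (insert C \<T>)
  then obtain A where A: "A \<in> \<T>" "\<forall>B \<in> \<T>. finite (A - B)"
    by (meson insertCI)
  consider "finite (A - C)" | "finite (C - A)"
    using insert.prems[of A C] A by blast
  then show ?case
  proof cases
    case 2
    have "finite (C - B)" if "B \<in> \<T>" for B
      by (rule finite_subset[of _ "(C - A) \<union> (A - B)"]) (use 2 A that in auto)
    then show ?thesis by auto
  qed (use A in auto)
qed auto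

text \<open>If \<open>J\<close> and all \<open>A n\<close> lie in a proper filter, the first
  alternative is impossible. The clause \<open>J \<subseteq> A 0\<close> makes constant sequences
  decide membership of a set.\<close>

definition settles :: "(nat \<Rightarrow> 'a set) \<Rightarrow> 'a set \<Rightarrow> bool" where
  "settles A J \<longleftrightarrow> (\<exists>n. J \<inter> A n = {}) \<or>
     (J \<subseteq> A 0 \<and> (\<forall>n. \<forall>x \<in> J \<inter> A n - A (Suc n). \<forall>y \<in> J \<inter> A n - A (Suc n). x = y))"

text \<open>Either infinitely many points of \<open>X\<close> avoid some \<open>A n\<close>, or
  infinitely many lie in every \<open>A n\<close>, or almost all of \<open>X\<close> is spread over
  the layers \<open>A n - A (Suc n)\<close> with finitely many points in each; then one point per
  occupied layer is kept.\<close>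

lemma infinite_subset_settles:
  assumes "infinite X" and "decseq A"
  shows "\<exists>J. infinite J \<and> J \<subseteq> X \<and> settles A J"
proof -
  consider (avoid) n where "infinite (X - A n)"
    | (inside) "infinite (X \<inter> (\<Inter>n. A n))"
    | (select) "\<And>n. finite (X - A n)" "finite (X \<inter> (\<Inter>n. A n))"
    by blast
  then show ?thesis
  proof cases
    case avoid
    then show ?thesis
      by (intro exI[of _ "X - A n"]) (auto simp: settles_def)
  next
    case inside
    then show ?thesis
      by (intro exI[of _ "X \<inter> (\<Inter>n. A n)"]) (auto simp: settles_def)
  next
    case select
    define Y where "Y = X \<inter> A 0 - (\<Inter>n. A n)"
    \<comment> \<open>For \<open>y\<close> in \<open>Y\<close>, \<open>p y\<close> is the index of
      the layer containing \<open>y\<close>.\<close>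
    define p where "p y = (LEAST n. y \<notin> A (Suc n))" for y
    have p: "y \<in> A n - A (Suc n) \<Longrightarrow> p y = n" for y n
      unfolding p_def using decseqD[OF assms(2)]
      by (intro Least_equality) (auto simp: not_less_eq_eq[symmetric], meson Suc_leI not_le subsetD)
    have p': "y \<notin> A (Suc (p y))" if "y \<in> Y" for y
    proof -
      from that obtain n where "y \<notin> A n" "y \<in> A 0"
        by (auto simp: Y_def)
      \<comment> \<open>Since \<open>y\<close> lies in \<open>A 0\<close>, the index
        \<open>n\<close> is not 0.\<close>
      then obtain m where "y \<notin> A (Suc m)"
        by (metis not0_implies_Suc)
      then show ?thesis
        unfolding p_def by (rule LeastI)
    qed
    have "X \<subseteq> Y \<union> (X - A 0) \<union> (X \<inter> (\<Inter>n. A n))"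
      by (auto simp: Y_def)
    then have "infinite Y"
      using assms(1) select finite_subset by (metis finite_UnI)
    moreover have "finite {y \<in> Y. p y = n}" for n
      by (rule finite_subset[OF _ select(1)[of "Suc n"]]) (use p' in \<open>auto simp: Y_def\<close>)
    ultimately have "infinite (p ` Y)"
      using pigeonhole_infinite[of Y p] by auto
    \<comment> \<open>\<open>J\<close> is a transversal of the fibres of \<open>p\<close>.\<close>
    moreover obtain J where J: "J \<subseteq> Y" "inj_on p J" "p ` Y = p ` J"
      using subset_image_inj[of "p ` Y" p Y] by blast
    ultimately have "infinite J"
      by auto
    moreover have "x = y" if "x \<in> J \<inter> A n - A (Suc n)" "y \<in> J \<inter> A n - A (Suc n)" for n x y
      using J(2) p[of x n] p[of y n] that by (metis DiffD1 DiffD2 DiffI IntD1 IntD2 inj_onD)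
    then have "settles A J"
      unfolding settles_def using J(1) by (auto simp: Y_def)
    ultimately show ?thesis
      using J(1) by (auto simp: Y_def)
  qed
qed

lemma continuum_hypothesis_settling_chain:
  assumes "continuum_hypothesis"
  obtains J :: "(nat \<Rightarrow> nat set) \<Rightarrow> nat set"
  where "\<And>A. infinite (J A)" "\<And>A. decseq A \<Longrightarrow> settles A (J A)"
    "\<And>A B. finite (J A - J B) \<or> finite (J B - J A)"
proof -
  obtain R :: "(nat \<Rightarrow> nat set) rel"
    where R: "wf R" "total R" "\<And>A. countable {B. (B, A) \<in> R}"
    using continuum_hypothesis_countable_segments[OF assms nat_set_sequences_lepoll_reals] by blast
  \<comment> \<open>\<open>P J A X\<close> says that \<open>X\<close> may be chosen at stage
    \<open>A\<close>; it consults \<open>J\<close> only at predecessors of \<open>A\<close>, as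
    well-founded recursion demands.\<close>
  define P where "P J A X \<longleftrightarrow> infinite X \<and> (decseq A \<longrightarrow> settles A X) \<and>
      (\<forall>B. (B, A) \<in> R \<longrightarrow> finite (X - J B))"
    for J :: "(nat \<Rightarrow> nat set) \<Rightarrow> nat set" and A :: "nat \<Rightarrow> nat set" and X
  have "\<exists>J. \<forall>A. P J A (J A)"
    using \<open>wf R\<close>
  proof (rule dependent_wf_choice)
    fix J J' :: "(nat \<Rightarrow> nat set) \<Rightarrow> nat set" and A X
    assume "\<And>B. (B, A) \<in> R \<Longrightarrow> J B = J' B"
    then show "P J A X = P J' A X"
      by (simp add: P_def)
  next
    fix A and J :: "(nat \<Rightarrow> nat set) \<Rightarrow> nat set"
    assume IH: "P J B (J B)" if "(B, A) \<in> R" for B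
    let ?\<C> = "J ` {B. (B, A) \<in> R}"
    \<comment> \<open>Of two earlier sets, the later one is almost contained in the other.\<close>
    have chain: "finite (C - D) \<or> finite (D - C)" if CD: "C \<in> ?\<C>" "D \<in> ?\<C>" for C D
    proof -
      obtain B B' where B: "(B, A) \<in> R" "(B', A) \<in> R" "C = J B" "D = J B'"
        using CD by blast
      have "B = B' \<or> (B, B') \<in> R \<or> (B', B) \<in> R"
        using \<open>total R\<close> by (auto simp: total_on_def)
      moreover have "(B, B') \<in> R \<Longrightarrow> finite (D - C)" "(B', B) \<in> R \<Longrightarrow> finite (C - D)"
        using IH[OF B(1)] IH[OF B(2)] unfolding P_def B(3,4) by simp_all
      ultimately show ?thesis
        using B(3,4) by auto
    qed
    \<comment> \<open>The least set of a finite subfamily is infinite and lies in the intersection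
      up to finitely many points.\<close>
    have fip: "infinite (\<Inter>\<T>)" if \<T>: "finite \<T>" "\<T> \<subseteq> ?\<C>" for \<T>
    proof (cases "\<T> = {}")
      case False
      have "\<exists>C \<in> \<T>. \<forall>D \<in> \<T>. finite (C - D)"
        using \<T>(2) by (intro finite_chain_mod_finite_least[OF \<T>(1) False] chain) auto
      then obtain C where C: "C \<in> \<T>" "\<forall>D \<in> \<T>. finite (C - D)" ..
      have "finite (\<Union>D\<in>\<T>. C - D)"
        using \<T>(1) C(2) by blast
      moreover have "infinite C"
      proof -
        obtain B where "(B, A) \<in> R" "C = J B"
          using C(1) \<T>(2) by blast
        then show ?thesis
          using IH[of B] by (simp add: P_def)
      qed
      moreover have "C \<subseteq> \<Inter>\<T> \<union> (\<Union>D\<in>\<T>. C - D)"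
        by blast
      ultimately show ?thesis
        using finite_subset by blast
    qed simp
    have "\<exists>X. infinite X \<and> (\<forall>C \<in> ?\<C>. finite (X - C))"
      using countable_image[OF R(3)] fip by (rule infinite_pseudo_intersection)
    then obtain X where X: "infinite X" "\<forall>C \<in> ?\<C>. finite (X - C)"
      by blast
    obtain Y where Y: "infinite Y" "Y \<subseteq> X" "decseq A \<longrightarrow> settles A Y"
    proof (cases "decseq A")
      case True
      then show ?thesis
        using infinite_subset_settles[OF X(1) True] that by blast
    next
      case False
      then show ?thesis
        using that[of X] X(1) by simp
    qed
    have "finite (Y - J B)" if B: "(B, A) \<in> R" for B
    proof (rule finite_subset)
      show "Y - J B \<subseteq> X - J B"
        using Y(2) by blast
      show "finite (X - J B)"
        using X(2) B by simp
    qed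
    with Y have "P J A Y"
      by (simp add: P_def)
    then show "\<exists>X. P J A X" ..
  qed
  then obtain J where J: "\<And>A. P J A (J A)"
    by blast
  have "finite (J A - J B) \<or> finite (J B - J A)" for A B
  proof -
    have "A = B \<or> (A, B) \<in> R \<or> (B, A) \<in> R"
      using \<open>total R\<close> by (auto simp: total_on_def)
    moreover have "(B, A) \<in> R \<Longrightarrow> finite (J A - J B)" "(A, B) \<in> R \<Longrightarrow> finite (J B - J A)"
      using J[of A] J[of B] unfolding P_def by simp_all
    ultimately show ?thesis
      by auto
  qed
  with J show thesis
    using that unfolding P_def by blast
qed

theorem theorem4p6:
  assumes "continuum_hypothesis"
  shows "\<exists>F :: nat filter. free_filter F \<and> ultrafilter F \<and> strongly_diagonal F"
proof -
  obtain J :: "(nat \<Rightarrow> nat set) \<Rightarrow> nat set"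
    where inf: "\<And>A. infinite (J A)" and settles: "\<And>A. decseq A \<Longrightarrow> settles A (J A)"
      and chain: "\<And>A B. finite (J A - J B) \<or> finite (J B - J A)"
    using continuum_hypothesis_settling_chain[OF assms] by blast
  define F where "F = (INF A. inf cofinite (principal (J A)))"
  have ev: "eventually Q F \<longleftrightarrow> (\<exists>A. finite (J A - Collect Q))" for Q
  proof -
    have "inf cofinite (principal X) \<le> inf cofinite (principal Y)" if "finite (X - Y)"
      for X Y :: "nat set"
    proof -
      have "eventually (\<lambda>x. x \<in> Y) (inf cofinite (principal X))"
        using that by (simp add: eventually_inf_principal eventually_cofinite set_diff_eq)
      then show ?thesis
        by (simp add: le_principal)
    qed
    \<comment> \<open>Almost inclusion of the \<open>J A\<close> is comparability of the generating
      filters. They form a chain, so one generator suffices to witness membership in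
      \<open>F\<close>.\<close>
    then have "eventually Q F \<longleftrightarrow> (\<exists>A. eventually Q (inf cofinite (principal (J A))))"
      unfolding F_def using chain by (subst eventually_INF_base) (auto, meson order_refl)
    then show ?thesis
      by (simp add: eventually_inf_principal eventually_cofinite set_diff_eq)
  qed
  have mem: "X \<in> filter_sets F \<longleftrightarrow> (\<exists>A. finite (J A - X))" for X
    by (simp add: filter_sets_def ev)
  have J_mem: "J A \<in> filter_sets F" for A
    using mem by (metis Diff_cancel finite.emptyI)
  have proper: "F \<noteq> bot"
    using inf by (simp add: trivial_limit_def ev)
  have Int: "X \<inter> Y \<in> filter_sets F" if "X \<in> filter_sets F" "Y \<in> filter_sets F" for X Y
    using that by (simp add: filter_sets_def eventually_conj)
  have nonempty: "X \<noteq> {}" if "X \<in> filter_sets F" for X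
    using that inf by (auto simp: mem)
  have "free_filter F"
    unfolding free_filter_def mem by (auto simp: Diff_eq)
  moreover have ultra: "X \<in> filter_sets F \<or> - X \<in> filter_sets F" for X
  proof -
    \<comment> \<open>For a constant sequence, the two alternatives of \<open>settles\<close> say
      that \<open>J\<close> misses \<open>X\<close> or lies inside it.\<close>
    have "J (\<lambda>_. X) \<subseteq> X \<or> J (\<lambda>_. X) \<subseteq> - X"
      using settles[of "\<lambda>_. X"] by (auto simp: settles_def decseq_def)
    then show ?thesis
      unfolding mem by (metis Diff_eq_empty_iff finite.emptyI)
  qed
  then have "ultrafilter F"
    using proper by (simp add: ultrafilter_iff)
  moreover have "strongly_diagonal F"
    unfolding strongly_diagonal_def
  proof (intro allI impI)
    fix A I
    assume A: "decseq A" "\<forall>n. A n \<in> filter_sets F" and I: "I \<in> stationary F"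
    \<comment> \<open>Otherwise the complement of \<open>I\<close>, which \<open>I\<close> does not
      meet, would belong to \<open>F\<close>.\<close>
    have "I \<in> filter_sets F"
      using ultra[of I] I by (auto simp: stationary_def)
    then have K: "J A \<inter> I \<in> filter_sets F"
      using Int J_mem by blast
    \<comment> \<open>This rules out the first alternative of \<open>settles\<close>.\<close>
    have "J A \<inter> A n \<noteq> {}" for n
      using A(2) Int J_mem nonempty by blast
    then have sel: "x = y" if "x \<in> J A \<inter> A n - A (Suc n)" "y \<in> J A \<inter> A n - A (Suc n)" for n x y
      using settles[OF A(1)] that unfolding settles_def by blast
    show "\<exists>K \<in> stationary F. K \<subseteq> I \<and>
        (\<forall>n. finite (K \<inter> A n - A (Suc n)) \<and> card (K \<inter> A n - A (Suc n)) \<le> 1)"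
    \<comment> \<open>The witness is \<open>J A \<inter> I\<close>: as a member of the proper filter
      \<open>F\<close> it is stationary, and shrinking \<open>J A\<close> preserves the bound on
      each layer.\<close>
    proof (intro bexI conjI allI)
      show "J A \<inter> I \<in> stationary F"
        unfolding stationary_def using Int[OF K] nonempty by blast
      fix n
      have "\<exists>x. J A \<inter> I \<inter> A n - A (Suc n) \<subseteq> {x}"
        using sel[of _ n] by blast
      then obtain x where x: "J A \<inter> I \<inter> A n - A (Suc n) \<subseteq> {x}" ..
      show "finite (J A \<inter> I \<inter> A n - A (Suc n))"
        using x finite_subset by blast
      show "card (J A \<inter> I \<inter> A n - A (Suc n)) \<le> 1"
        using card_mono[OF _ x] by simp
    qed auto
  qed
  ultimately show ?thesis
    by blast
qed

end
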